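(* Let $M$ be a group, let $A$ be an $M$-act and let $B$ be a large subact of $A$ (i.e. a subact with $A\setminus B$ finite). If $A$ is finitely presented, then $B$ is finitely presented.
   Context: Let $M$ be a monoid with identity $1$. A (right) $M$-act is a non-empty set $A$ with a map $A\times M\to A$, $(a,m)\mapsto am$, with $a(mn)=(am)n$ and $a1=a$. A subact of $A$ is a non-empty subset $B$ with $bm\in B$ for all $b\in B$, $m\in M$. A congruence on $A$ is an equivalence relation $\rho$ with $(a,b)\in\rho\Rightarrow(am,bm)\in\rho$ for all $m\in M$. For a set $X$, $F_X=X\times M$ is the free $M$-act with $(x,m)n=(x,mn)$. A presentation $\langle X\,|\,R\rangle$ consists of a non-empty set $X$ and a set $R\subseteq F_X\times F_X$; an $M$-act is defined by it if it is isomorphic to $F_X/\rho$, where $\rho$ is the smallest congruence on $F_X$ containing $R$. An $M$-act is finitely presented if it is defined by some presentation $\langle X\,|\,R\rangle$ with $X$ and $R$ finite. *)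

theory Defs
  imports "HOL-Algebra.Group"
begin

text \<open>
  A right act over a monoid \<open>M\<close> is given by its carrier set \<open>A\<close> and an action
  \<open>act :: 'a \<Rightarrow> 'm \<Rightarrow> 'a\<close>, which matters only on \<open>A\<close> and \<open>carrier M\<close>.
\<close>

locale monoid_act = monoid M for M (structure) +
  fixes A :: "'a set" and act :: "'a \<Rightarrow> 'm \<Rightarrow> 'a"
  assumes nonempty: "A \<noteq> {}"
    and act_closed: "\<lbrakk>a \<in> A; m \<in> carrier M\<rbrakk> \<Longrightarrow> act a m \<in> A"
    and act_mult: "\<lbrakk>a \<in> A; m \<in> carrier M; n \<in> carrier M\<rbrakk> \<Longrightarrow> act a (m \<otimes> n) = act (act a m) n"
    and act_one: "a \<in> A \<Longrightarrow> act a \<one> = a"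

definition subact ::
    "('m, 'k) monoid_scheme \<Rightarrow> 'a set \<Rightarrow> ('a \<Rightarrow> 'm \<Rightarrow> 'a) \<Rightarrow> 'a set \<Rightarrow> bool" where
  "subact M A act B \<longleftrightarrow>
    B \<noteq> {} \<and> B \<subseteq> A \<and> (\<forall>b\<in>B. \<forall>m\<in>carrier M. act b m \<in> B)"

definition large_subact ::
    "('m, 'k) monoid_scheme \<Rightarrow> 'a set \<Rightarrow> ('a \<Rightarrow> 'm \<Rightarrow> 'a) \<Rightarrow> 'a set \<Rightarrow> bool" where
  "large_subact M A act B \<longleftrightarrow> subact M A act B \<and> finite (A - B)"

definition act_congruence ::
    "('m, 'k) monoid_scheme \<Rightarrow> 'a set \<Rightarrow> ('a \<Rightarrow> 'm \<Rightarrow> 'a) \<Rightarrow> ('a \<times> 'a) set \<Rightarrow> bool" where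
  "act_congruence M A act \<rho> \<longleftrightarrow>
    equiv A \<rho> \<and> (\<forall>(a, b)\<in>\<rho>. \<forall>m\<in>carrier M. (act a m, act b m) \<in> \<rho>)"

definition generated_congruence ::
    "('m, 'k) monoid_scheme \<Rightarrow> 'a set \<Rightarrow> ('a \<Rightarrow> 'm \<Rightarrow> 'a) \<Rightarrow> ('a \<times> 'a) set \<Rightarrow> ('a \<times> 'a) set" where
  "generated_congruence M A act R = \<Inter> {\<rho>. act_congruence M A act \<rho> \<and> R \<subseteq> \<rho>}"

lemma act_congruence_generated_congruence:
  assumes "monoid_act M A act" and "R \<subseteq> A \<times> A"
  shows "act_congruence M A act (generated_congruence M A act R)"
    and "R \<subseteq> generated_congruence M A act R"
    and "act_congruence M A act \<rho> \<Longrightarrow> R \<subseteq> \<rho> \<Longrightarrow> generated_congruence M A act R \<subseteq> \<rho>"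
proof -
  let ?S = "{\<rho>. act_congruence M A act \<rho> \<and> R \<subseteq> \<rho>}"
  have top: "A \<times> A \<in> ?S"
    using assms monoid_act.act_closed[OF assms(1)]
    by (auto simp: act_congruence_def equiv_def refl_on_def sym_def trans_def)
  have eq: "equiv A \<rho>" if "\<rho> \<in> ?S" for \<rho>
    using that by (simp add: act_congruence_def)
  have "equiv A (\<Inter> ?S)"
  proof (rule equivI)
    show "\<Inter> ?S \<subseteq> A \<times> A" using top by blast
    show "refl_on A (\<Inter> ?S)" using eq by (auto simp: equiv_def refl_on_def)
    show "sym (\<Inter> ?S)" using eq by (auto simp: equiv_def intro!: symI elim: symE)
    show "trans (\<Inter> ?S)" using eq unfolding equiv_def trans_def by blast
  qed
  moreover have "\<forall>(a, b)\<in>\<Inter> ?S. \<forall>m\<in>carrier M. (act a m, act b m) \<in> \<Inter> ?S"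
    unfolding act_congruence_def by blast
  ultimately show "act_congruence M A act (generated_congruence M A act R)"
    unfolding generated_congruence_def act_congruence_def[of M A act "\<Inter> ?S"] by blast
  show "R \<subseteq> generated_congruence M A act R"
    and "act_congruence M A act \<rho> \<Longrightarrow> R \<subseteq> \<rho> \<Longrightarrow> generated_congruence M A act R \<subseteq> \<rho>"
    by (auto simp: generated_congruence_def)
qed

text \<open>
  The quotient act has carrier \<open>A // \<rho>\<close>. Its action is written without choosing
  representatives; the lemma below gives the usual formula.
\<close>

definition quotient_act ::
    "('a \<times> 'a) set \<Rightarrow> ('a \<Rightarrow> 'm \<Rightarrow> 'a) \<Rightarrow> 'a set \<Rightarrow> 'm \<Rightarrow> 'a set" where
  "quotient_act \<rho> act C m = (\<Union>a\<in>C. \<rho> `` {act a m})"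

lemma quotient_act_class:
  assumes "act_congruence M A act \<rho>" and "a \<in> A" and "m \<in> carrier M"
  shows "quotient_act \<rho> act (\<rho> `` {a}) m = \<rho> `` {act a m}"
proof -
  have eq: "equiv A \<rho>" using assms(1) by (simp add: act_congruence_def)
  have "\<rho> `` {act b m} = \<rho> `` {act a m}" if "b \<in> \<rho> `` {a}" for b
    using that assms(1,3) equiv_class_eq[OF eq] by (fastforce simp: act_congruence_def)
  moreover have "a \<in> \<rho> `` {a}" using equiv_class_self[OF eq assms(2)] .
  ultimately show ?thesis unfolding quotient_act_def by blast
qed

definition act_isomorphic ::
    "('m, 'k) monoid_scheme \<Rightarrow> 'a set \<Rightarrow> ('a \<Rightarrow> 'm \<Rightarrow> 'a) \<Rightarrow> 'b set \<Rightarrow> ('b \<Rightarrow> 'm \<Rightarrow> 'b) \<Rightarrow> bool" where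
  "act_isomorphic M A act A' act' \<longleftrightarrow>
    (\<exists>f. bij_betw f A A' \<and> (\<forall>a\<in>A. \<forall>m\<in>carrier M. f (act a m) = act' (f a) m))"

definition free_act_carrier :: "('m, 'k) monoid_scheme \<Rightarrow> 'x set \<Rightarrow> ('x \<times> 'm) set" where
  "free_act_carrier M X = X \<times> carrier M"

definition free_act :: "('m, 'k) monoid_scheme \<Rightarrow> 'x \<times> 'm \<Rightarrow> 'm \<Rightarrow> 'x \<times> 'm" where
  "free_act M p n = (fst p, snd p \<otimes>\<^bsub>M\<^esub> n)"

definition act_presentation ::
    "('m, 'k) monoid_scheme \<Rightarrow> 'x set \<Rightarrow> (('x \<times> 'm) \<times> ('x \<times> 'm)) set \<Rightarrow> bool" where
  "act_presentation M X R \<longleftrightarrow> X \<noteq> {} \<and> R \<subseteq> free_act_carrier M X \<times> free_act_carrier M X"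

definition defined_by_presentation ::
    "('m, 'k) monoid_scheme \<Rightarrow> 'a set \<Rightarrow> ('a \<Rightarrow> 'm \<Rightarrow> 'a) \<Rightarrow>
     'x set \<Rightarrow> (('x \<times> 'm) \<times> ('x \<times> 'm)) set \<Rightarrow> bool" where
  "defined_by_presentation M A act X R \<longleftrightarrow>
    act_presentation M X R \<and>
    (let \<rho> = generated_congruence M (free_act_carrier M X) (free_act M) R
     in act_isomorphic M A act (free_act_carrier M X // \<rho>) (quotient_act \<rho> (free_act M)))"

text \<open>
  HOL cannot quantify existentially over the type of the generators. As only finite generating
  sets matter here, and these can be relabelled by natural numbers, \<open>X :: nat set\<close> loses nothing.
\<close>

definition finitely_presented_act ::
    "('m, 'k) monoid_scheme \<Rightarrow> 'a set \<Rightarrow> ('a \<Rightarrow> 'm \<Rightarrow> 'a) \<Rightarrow> bool" where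
  "finitely_presented_act M A act \<longleftrightarrow>
    monoid_act M A act \<and>
    (\<exists>(X :: nat set) R. finite X \<and> finite R \<and> defined_by_presentation M A act X R)"

end

theory Submission
  imports Defs
begin

text \<open>
  Let \<open>\<pi>\<close> be the projection of the free act on \<open>X\<close> onto \<open>A\<close> given by a presentation
  \<open>\<langle>X | R\<rangle>\<close>. Over a group, \<open>\<pi> (x, m) \<in> B\<close> if and only if \<open>\<pi> (x, \<one>) \<in> B\<close>, so the preimage of
  \<open>B\<close> is free on \<open>Y = {x \<in> X. \<pi> (x, \<one>) \<in> B}\<close>, and a relation in \<open>R\<close> involves either only
  generators from \<open>Y\<close> or only generators from \<open>X - Y\<close>. Hence \<open>B\<close> is presented by \<open>Y\<close> and the
  relations in \<open>R\<close> over \<open>Y\<close>: the congruence \<open>\<sigma>\<close> these generate on the free act on \<open>Y\<close>, together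
  with the full relation on the free act on \<open>X - Y\<close>, is a congruence containing \<open>R\<close>,
  so it contains the kernel of \<open>\<pi>\<close>.
\<close>

lemma (in monoid) monoid_act_free_act:
  assumes "X \<noteq> {}"
  shows "monoid_act G (free_act_carrier G X) (free_act G)"
  by unfold_locales (use assms in \<open>auto simp: free_act_carrier_def free_act_def m_assoc\<close>)

lemma monoid_act_subact:
  assumes "monoid_act M A act" and "subact M A act B"
  shows "monoid_act M B act"
proof -
  interpret monoid_act M A act by fact
  show ?thesis
    by unfold_locales (use assms(2) in \<open>auto simp: subact_def act_mult act_one subset_iff\<close>)
qed

text \<open>The target enters only through its action, with no carrier; where the values lie is
  fixed separately by a condition on the image.\<close>

definition act_hom ::
    "('m, 'k) monoid_scheme \<Rightarrow> 'a set \<Rightarrow> ('a \<Rightarrow> 'm \<Rightarrow> 'a) \<Rightarrow> ('b \<Rightarrow> 'm \<Rightarrow> 'b) \<Rightarrow> ('a \<Rightarrow> 'b) \<Rightarrow> bool" where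
  "act_hom M A act act' f \<longleftrightarrow> (\<forall>a\<in>A. \<forall>m\<in>carrier M. f (act a m) = act' (f a) m)"

definition act_kernel :: "'a set \<Rightarrow> ('a \<Rightarrow> 'b) \<Rightarrow> ('a \<times> 'a) set" where
  "act_kernel A f = {(a, b). a \<in> A \<and> b \<in> A \<and> f a = f b}"

lemma act_congruence_kernel:
  assumes "monoid_act M A act" and "act_hom M A act act' f"
  shows "act_congruence M A act (act_kernel A f)"
  using assms(2) monoid_act.act_closed[OF assms(1)]
  by (auto simp: act_congruence_def act_kernel_def act_hom_def
      intro!: equivI refl_onI symI transI)

text \<open>The first isomorphism theorem, read in both directions. It replaces maps into sets of
  classes by a projection \<pi> from \<open>F\<close>, which can be restricted to subacts.\<close>

lemma act_isomorphic_quotient_iff: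
  assumes A: "monoid_act M A act" and F: "monoid_act M F actF"
    and \<rho>: "act_congruence M F actF \<rho>"
  shows "act_isomorphic M A act (F // \<rho>) (quotient_act \<rho> actF) \<longleftrightarrow>
    (\<exists>\<pi>. act_hom M F actF act \<pi> \<and> \<pi> ` F = A \<and> act_kernel F \<pi> = \<rho>)"
    (is "?iso \<longleftrightarrow> ?proj")
proof
  have eq: "equiv F \<rho>" using \<rho> by (simp add: act_congruence_def)
  note sub = equiv_type[OF eq]
  note A_closed = monoid_act.act_closed[OF A]
  note F_closed = monoid_act.act_closed[OF F]
  {
    assume ?iso
    then obtain f where bij: "bij_betw f A (F // \<rho>)"
      and f: "\<And>a m. a \<in> A \<Longrightarrow> m \<in> carrier M \<Longrightarrow> f (act a m) = quotient_act \<rho> actF (f a) m"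
      unfolding act_isomorphic_def by blast
    \<comment> \<open>The quotient map followed by the inverse of the isomorphism
      \<open>f\<close>.\<close>
    define \<pi> where "\<pi> p = the_inv_into A f (\<rho> `` {p})" for p
    have inj: "inj_on f A" and img: "f ` A = F // \<rho>"
      using bij by (auto simp: bij_betw_def)
    have \<pi>_in: "\<pi> p \<in> A" if "p \<in> F" for p
      unfolding \<pi>_def using that img by (intro the_inv_into_into[OF inj]) (auto intro: quotientI)
    have f_\<pi>: "f (\<pi> p) = \<rho> `` {p}" if "p \<in> F" for p
      unfolding \<pi>_def using that img by (intro f_the_inv_into_f[OF inj]) (auto intro: quotientI)
    have "\<pi> (actF p m) = act (\<pi> p) m" if p: "p \<in> F" and m: "m \<in> carrier M" for p m
    proof (rule inj_onD[OF inj])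
      show "f (\<pi> (actF p m)) = f (act (\<pi> p) m)"
        using p m by (simp add: f f_\<pi> \<pi>_in F_closed quotient_act_class[OF \<rho>])
    qed (use p m in \<open>simp_all add: \<pi>_in A_closed F_closed\<close>)
    moreover have "\<pi> ` F = A"
    proof
      show "A \<subseteq> \<pi> ` F"
      proof
        fix a assume a: "a \<in> A"
        then have "f a \<in> F // \<rho>" using img by blast
        then obtain p where "p \<in> F" "f a = \<rho> `` {p}" by (rule quotientE)
        then show "a \<in> \<pi> ` F"
          using a by (metis \<pi>_def the_inv_into_f_f[OF inj] imageI)
      qed
    qed (use \<pi>_in in blast)
    moreover have "act_kernel F \<pi> = \<rho>"
    proof -
      \<comment> \<open>Forwards, apply \<open>f\<close>; backwards, \<pi> depends only on the class
        of its argument.\<close>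
      have "\<pi> p = \<pi> q \<longleftrightarrow> (p, q) \<in> \<rho>" if "p \<in> F" "q \<in> F" for p q
        using that f_\<pi> eq_equiv_class_iff[OF eq, of p q] by (metis \<pi>_def)
      then show ?thesis using sub by (auto simp: act_kernel_def)
    qed
    ultimately show ?proj unfolding act_hom_def by blast
  next
    assume ?proj
    then obtain \<pi> where hom: "\<And>p m. p \<in> F \<Longrightarrow> m \<in> carrier M \<Longrightarrow> \<pi> (actF p m) = act (\<pi> p) m"
      and surj: "\<pi> ` F = A" and ker: "act_kernel F \<pi> = \<rho>"
      unfolding act_hom_def by blast
    \<comment> \<open>The fibre of \<pi> over \<open>a\<close>, which is a class of \<rho> because
      \<rho> is the kernel.\<close>
    define f where "f a = {p \<in> F. \<pi> p = a}" for a
    have f_\<pi>: "f (\<pi> p) = \<rho> `` {p}" if "p \<in> F" for p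
      using that by (auto simp: f_def ker[symmetric] act_kernel_def)
    \<comment> \<open>Surjectivity makes these fibres non-empty, so each determines its base
      point.\<close>
    have "inj_on f A"
      using surj by (intro inj_onI) (auto simp: f_def)
    moreover have "f ` A = F // \<rho>"
      by (auto simp: surj[symmetric] f_\<pi> quotient_def image_image)
    moreover have "f (act a m) = quotient_act \<rho> actF (f a) m"
      if "a \<in> A" and m: "m \<in> carrier M" for a m
    proof -
      obtain p where "p \<in> F" "a = \<pi> p" using \<open>a \<in> A\<close> surj by blast
      then show ?thesis
        using m f_\<pi>[of "actF p m"] by (simp add: hom f_\<pi> F_closed quotient_act_class[OF \<rho>])
    qed
    ultimately show ?iso unfolding act_isomorphic_def bij_betw_def by blast
  }
qed

lemma defined_by_presentation_iff:
  assumes A: "monoid_act M A act"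
  shows "defined_by_presentation M A act X R \<longleftrightarrow> act_presentation M X R \<and>
    (\<exists>\<pi>. act_hom M (free_act_carrier M X) (free_act M) act \<pi> \<and> \<pi> ` free_act_carrier M X = A \<and>
      act_kernel (free_act_carrier M X) \<pi> =
        generated_congruence M (free_act_carrier M X) (free_act M) R)"
proof (cases "act_presentation M X R")
  case True
  interpret monoid_act M A act by fact
  have F: "monoid_act M (free_act_carrier M X) (free_act M)"
    using True by (intro monoid_act_free_act) (simp add: act_presentation_def)
  moreover have "R \<subseteq> free_act_carrier M X \<times> free_act_carrier M X"
    using True by (simp add: act_presentation_def)
  ultimately show ?thesis
    using True act_isomorphic_quotient_iff[OF A F act_congruence_generated_congruence(1)]
    by (simp add: defined_by_presentation_def Let_def)
qed (simp add: defined_by_presentation_def)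

text \<open>Generators and relations are selected from the given ones, so finiteness of
  \<open>X\<close> and \<open>R\<close> passes to the new presentation.\<close>

lemma defined_by_presentation_subact:
  fixes M (structure)
  assumes "group M" and A: "monoid_act M A act" and B: "subact M A act B"
    and pres: "defined_by_presentation M A act X R"
  shows "\<exists>Y\<subseteq>X. \<exists>S\<subseteq>R. defined_by_presentation M B act Y S"
proof -
  interpret group M by fact
  interpret A: monoid_act M A act by fact
  let ?F = "free_act_carrier M"
    and ?gen = "\<lambda>X. generated_congruence M (free_act_carrier M X) (free_act M)"
  obtain \<pi> where R: "R \<subseteq> ?F X \<times> ?F X" and "X \<noteq> {}"
    and hom: "act_hom M (?F X) (free_act M) act \<pi>"
    and surj: "\<pi> ` ?F X = A" and ker: "act_kernel (?F X) \<pi> = ?gen X R"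
    using pres by (auto simp: defined_by_presentation_iff[OF A] act_presentation_def)
  have BA: "B \<subseteq> A" and B_closed: "\<And>b m. b \<in> B \<Longrightarrow> m \<in> carrier M \<Longrightarrow> act b m \<in> B"
    and "B \<noteq> {}"
    using B by (auto simp: subact_def)
  define Y where "Y = {x \<in> X. \<pi> (x, \<one>) \<in> B}"
  define S where "S = R \<inter> ?F Y \<times> ?F Y"
  define \<sigma> where "\<sigma> = ?gen Y S"
  have preimage: "p \<in> ?F Y \<longleftrightarrow> \<pi> p \<in> B" if "p \<in> ?F X" for p
  proof -
    obtain x m where p: "p = (x, m)" and x: "x \<in> X" and m: "m \<in> carrier M"
      using \<open>p \<in> ?F X\<close> by (auto simp: free_act_carrier_def)
    have \<pi>_p: "\<pi> (x, m) = act (\<pi> (x, \<one>)) m"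
      using bspec[OF bspec[OF hom[unfolded act_hom_def], of "(x, \<one>)"] m] x m
      by (simp add: free_act_carrier_def free_act_def)
    have "\<pi> (x, \<one>) \<in> A" using surj x by (auto simp: free_act_carrier_def)
    \<comment> \<open>Here the group enters: undoing \<open>m\<close> shows that an orbit meeting
      \<open>B\<close> lies inside \<open>B\<close>.\<close>
    then have "\<pi> (x, \<one>) = act (\<pi> (x, m)) (inv m)"
      using m by (simp add: \<pi>_p A.act_mult[symmetric] A.act_one)
    then have "\<pi> (x, \<one>) \<in> B \<longleftrightarrow> \<pi> (x, m) \<in> B"
      using B_closed m \<pi>_p by (metis inv_closed)
    then show ?thesis using p x m by (simp add: Y_def free_act_carrier_def)
  qed
  have FY: "?F Y \<subseteq> ?F X" by (auto simp: Y_def free_act_carrier_def)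
  have surj_Y: "\<pi> ` ?F Y = B"
    using preimage surj BA FY by blast
  have "Y \<noteq> {}" using surj_Y \<open>B \<noteq> {}\<close> by (auto simp: free_act_carrier_def)
  have act_FY: "monoid_act M (?F Y) (free_act M)" using \<open>Y \<noteq> {}\<close> by (rule monoid_act_free_act)
  have act_FX: "monoid_act M (?F X) (free_act M)" using \<open>X \<noteq> {}\<close> by (rule monoid_act_free_act)
  have S: "S \<subseteq> ?F Y \<times> ?F Y" by (simp add: S_def)
  have R_ker: "R \<subseteq> act_kernel (?F X) \<pi>"
    using act_congruence_generated_congruence(2)[OF act_FX R] ker by simp
  have hom_Y: "act_hom M (?F Y) (free_act M) act \<pi>"
    using hom FY by (auto simp: act_hom_def)
  have \<sigma>: "act_congruence M (?F Y) (free_act M) \<sigma>" "S \<subseteq> \<sigma>"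
    unfolding \<sigma>_def using act_congruence_generated_congruence[OF act_FY S] by blast+
  have \<sigma>_eq: "equiv (?F Y) \<sigma>"
    using \<sigma>(1) by (simp add: act_congruence_def)
  note \<sigma>_type = equiv_type[OF \<sigma>_eq]
  define D where "D = ?F X - ?F Y"
  \<comment> \<open>As a set of all pairs over \<open>X - Y\<close>, the complement is also closed
    under the action.\<close>
  have D_eq: "D = ?F (X - Y)" by (auto simp: D_def free_act_carrier_def)
  have "act_congruence M (?F X) (free_act M) (\<sigma> \<union> D \<times> D)"
    unfolding act_congruence_def
  proof
    have "refl_on (?F Y) \<sigma>" "sym \<sigma>" "trans \<sigma>"
      using \<sigma>_eq by (auto simp: equiv_def)
    then show "equiv (?F X) (\<sigma> \<union> D \<times> D)"
    proof (intro equivI)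
      show "\<sigma> \<union> D \<times> D \<subseteq> ?F X \<times> ?F X"
        using \<sigma>_type FY by (auto simp: D_def)
      show "refl_on (?F X) (\<sigma> \<union> D \<times> D)"
        using \<open>refl_on (?F Y) \<sigma>\<close> by (auto simp: refl_on_def D_def)
      show "sym (\<sigma> \<union> D \<times> D)"
        using \<open>sym \<sigma>\<close> by (auto simp: sym_def)
      \<comment> \<open>No chain passes from one part to the other, since \<sigma> lives on
        \<open>?F Y\<close>, which is disjoint from \<open>D\<close>.\<close>
      show "trans (\<sigma> \<union> D \<times> D)"
        using \<open>trans \<sigma>\<close> \<sigma>_type unfolding D_def trans_def by blast
    qed
    show "\<forall>(p, q)\<in>\<sigma> \<union> D \<times> D. \<forall>m\<in>carrier M. (free_act M p m, free_act M q m) \<in> \<sigma> \<union> D \<times> D"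
      using \<sigma>(1) by (auto simp: act_congruence_def D_eq free_act_carrier_def free_act_def)
  qed
  moreover have "R \<subseteq> \<sigma> \<union> D \<times> D"
  proof
    fix r assume "r \<in> R"
    moreover obtain p q where r: "r = (p, q)" by (cases r)
    ultimately have "p \<in> ?F X" "q \<in> ?F X" "\<pi> p = \<pi> q"
      using R_ker by (auto simp: act_kernel_def)
    \<comment> \<open>Both sides have the same image in \<open>A\<close>, so by
      \<open>preimage\<close> they lie together in \<open>?F Y\<close> or together in
      \<open>D\<close>.\<close>
    then show "r \<in> \<sigma> \<union> D \<times> D"
      using \<open>r \<in> R\<close> \<sigma>(2) preimage[of p] preimage[of q] by (auto simp: r S_def D_def)
  qed
  ultimately have "act_kernel (?F X) \<pi> \<subseteq> \<sigma> \<union> D \<times> D"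
    unfolding ker by (rule act_congruence_generated_congruence(3)[OF act_FX R])
  \<comment> \<open>A pair over \<open>Y\<close> cannot belong to
    \<open>D \<times> D\<close>.\<close>
  then have "act_kernel (?F Y) \<pi> \<subseteq> \<sigma>"
    using FY by (auto simp: act_kernel_def D_def)
  moreover have "S \<subseteq> act_kernel (?F Y) \<pi>"
    using R_ker by (auto simp: S_def act_kernel_def)
  \<comment> \<open>Minimality of \<sigma>: the kernel of the restricted projection is a congruence
    containing \<open>S\<close>.\<close>
  then have "\<sigma> \<subseteq> act_kernel (?F Y) \<pi>"
    unfolding \<sigma>_def
    by (intro act_congruence_generated_congruence(3)[OF act_FY S]
        act_congruence_kernel[OF act_FY hom_Y])
  ultimately have "defined_by_presentation M B act Y S"
    using \<open>Y \<noteq> {}\<close> S hom_Y surj_Y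
    by (auto simp: defined_by_presentation_iff[OF monoid_act_subact[OF A B]]
        act_presentation_def \<sigma>_def)
  moreover have "Y \<subseteq> X" "S \<subseteq> R" by (auto simp: Y_def S_def)
  ultimately show ?thesis by blast
qed

theorem lemma6p11:
  fixes M :: "('m, 'k) monoid_scheme"
    and A B :: "'a set"
    and act :: "'a \<Rightarrow> 'm \<Rightarrow> 'a"
  assumes "group M"
    and "monoid_act M A act"
    and "large_subact M A act B"
    and "finitely_presented_act M A act"
  shows "finitely_presented_act M B act"
proof -
  have B: "subact M A act B"
    using assms(3) by (simp add: large_subact_def)
  obtain X :: "nat set" and R where "finite X" "finite R" "defined_by_presentation M A act X R"
    using assms(4) by (auto simp: finitely_presented_act_def)
  then show ?thesis
    using defined_by_presentation_subact[OF assms(1,2) B] monoid_act_subact[OF assms(2) B]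
    unfolding finitely_presented_act_def by (meson finite_subset)
qed

end
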